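(* Let $G=(N,E)$ be a finite directed graph, $T\ge1$ an integer, $H:\mathbb R^E_{\ge0}\times\mathbb Z_{\ge1}\to\mathbb R$ a time dependent potential, and for each integer $T'\geq 1$ let $H^{T'}(i)=\sum_{t=1}^{T'}H(i(t),t)$. Let $(i,u)\in\mathbb R^{E^{T,\Omega}}_{\ge0}\times\mathbb R^{N^{T,\Omega}}$ be such that $$\min\{i,\nabla H^T(i)-Du\}=0\text{ in }E^{T,\Omega},\qquad \operatorname{div}i=0\text{ in }N\times\{1,\dots,T\}.$$ Let $j\in\mathbb R^{E^{T+1,\Omega}}_{\ge0}$ be the extension of $i$ by zero (equal to $i$ on $E^{T,\Omega}$ and $0$ on $E^{T+1,\Omega}\setminus E^{T,\Omega}$). If for every $e=(x,y)\in E$ $$\partial_eH(0,T+1)+u(x,T)-u(y,\Omega)\ge0,$$ then there exists $v\in\mathbb R^{N^{T+1,\Omega}}$ such that $$\min\{j,\nabla H^{T+1}(j)-Dv\}=0\text{ in }E^{T+1,\Omega}.$$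
   Context: A directed graph is $G=(N,E)$ with $N$ finite and $E\subseteq N\times N$; for an edge $e=(x,y)$, $e^-=x$, $e^+=y$. $\mathbb R^X$ is the set of functions $X\to\mathbb R$. On any directed graph, $\operatorname{div}i(x)=\sum_{e^-=x}i(e)-\sum_{e^+=x}i(e)$ and $Du(e)=u(e^+)-u(e^-)$. Minima in equations are coordinatewise. Extended graphs: for an integer $T\ge1$, $N^T=N\times\{0,\dots,T\}$, and $E^T$ consists of the edges $(e,t):=((x,t-1),(y,t))$ for $e=(x,y)\in E$, $t\in\{1,\dots,T\}$. With a symbol $\Omega$, $N^\Omega=N\times\{\Omega\}$, and $N^{T,\Omega}=N^T\cup N^\Omega$, $E^{T,\Omega}=E^T\cup\{((x,t),(x,\Omega)): x\in N,\ t\in\{1,\dots,T\}\}$. For $i\in\mathbb R^{E^{T,\Omega}}$ and $t\in\{1,\dots,T\}$, $i(t)\in\mathbb R^E$ denotes $e\mapsto i(e,t)$. A time dependent potential is a function $H:\mathbb R^E_{\ge0}\times\mathbb Z_{\ge1}\to\mathbb R$ with each $H(\cdot,t)$ continuously differentiable (up to the boundary); $\partial_eH(i,t)$ is the derivative in the coordinate $i_e$. $H^T$ is regarded as a function on $\mathbb R^{E^{T,\Omega}}_{\ge0}$ independent of the coordinates of edges ending in $N^\Omega$, so $\partial_{(e,t)}H^T(i)=\partial_eH(i(t),t)$ and $\nabla H^T=0$ on edges ending in $N^\Omega$. *)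

theory Defs
  imports "HOL-Analysis.Analysis"
begin

text \<open>
  A finite directed graph is given by a finite vertex set \<open>N\<close> and an edge set
  \<open>E \<subseteq> N \<times> N\<close>; the edge \<open>e\<close> has \<open>e\<^sup>- = fst e\<close> and \<open>e\<^sup>+ = snd e\<close>.
  For a set \<open>X\<close>, the space of real functions on \<open>X\<close> is the set of extensional functions
  \<open>X \<rightarrow>\<^sub>E UNIV\<close>, and its nonnegative orthant is \<open>X \<rightarrow>\<^sub>E {0..}\<close>.
\<close>

definition divergence :: "('v \<times> 'v) set \<Rightarrow> ('v \<times> 'v \<Rightarrow> real) \<Rightarrow> 'v \<Rightarrow> real" where
  "divergence E i x = (\<Sum>e \<in> {e \<in> E. fst e = x}. i e) - (\<Sum>e \<in> {e \<in> E. snd e = x}. i e)"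

definition difference :: "('v \<Rightarrow> real) \<Rightarrow> 'v \<times> 'v \<Rightarrow> real" where
  "difference u e = u (snd e) - u (fst e)"


subsection \<open>Extended graphs\<close>

datatype layer = Time nat | Omega

definition ext_nodes :: "'a set \<Rightarrow> nat \<Rightarrow> ('a \<times> layer) set" where
  "ext_nodes N T = N \<times> Time ` {0..T} \<union> N \<times> {Omega}"

text \<open>The edge \<open>(e, t)\<close>; it is only used for \<open>t \<ge> 1\<close>.\<close>

definition time_edge :: "'a \<times> 'a \<Rightarrow> nat \<Rightarrow> ('a \<times> layer) \<times> ('a \<times> layer)" where
  "time_edge e t = ((fst e, Time (t - 1)), (snd e, Time t))"

definition exit_edge :: "'a \<Rightarrow> nat \<Rightarrow> ('a \<times> layer) \<times> ('a \<times> layer)" where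
  "exit_edge x t = ((x, Time t), (x, Omega))"

definition ext_edges ::
    "'a set \<Rightarrow> ('a \<times> 'a) set \<Rightarrow> nat \<Rightarrow> (('a \<times> layer) \<times> ('a \<times> layer)) set" where
  "ext_edges N E T =
     {time_edge e t | e t. e \<in> E \<and> t \<in> {1..T}} \<union> {exit_edge x t | x t. x \<in> N \<and> t \<in> {1..T}}"

text \<open>The function written \<open>i(t)\<close> on \<open>E\<close>.\<close>

definition time_slice ::
    "('a \<times> 'a) set \<Rightarrow> (('a \<times> layer) \<times> ('a \<times> layer) \<Rightarrow> real) \<Rightarrow> nat \<Rightarrow> 'a \<times> 'a \<Rightarrow> real" where
  "time_slice E i t = (\<lambda>e\<in>E. i (time_edge e t))"


subsection \<open>Potentials on the nonnegative orthant\<close>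

text \<open>
  Partial derivative in the coordinate \<open>e\<close> of a function on a nonnegative orthant;
  it is one-sided at points where that coordinate vanishes.
\<close>

definition partial_deriv :: "(('e \<Rightarrow> real) \<Rightarrow> real) \<Rightarrow> 'e \<Rightarrow> ('e \<Rightarrow> real) \<Rightarrow> real" where
  "partial_deriv f e i = vector_derivative (\<lambda>s. f (i(e := s))) (at (i e) within {0..})"

text \<open>
  Continuous differentiability up to the boundary of the orthant over the finite index set
  \<open>X\<close>: a Frechet derivative relative to the orthant exists at every point, boundary points
  included, and depends continuously on the point. It is written out with the Euclidean norm
  \<open>L2_set\<close>, because the function type carries the product topology but no norm.
\<close>

definition C1_orthant :: "'e set \<Rightarrow> (('e \<Rightarrow> real) \<Rightarrow> real) \<Rightarrow> bool" where
  "C1_orthant X f \<longleftrightarrow>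
     (\<exists>g. (\<forall>e\<in>X. continuous_on (X \<rightarrow>\<^sub>E {0..}) (\<lambda>i. g i e)) \<and>
          (\<forall>i \<in> X \<rightarrow>\<^sub>E {0..}.
             ((\<lambda>k. (f k - f i - (\<Sum>e\<in>X. g i e * (k e - i e))) / L2_set (\<lambda>e. k e - i e) X)
                \<longlongrightarrow> 0) (at i within (X \<rightarrow>\<^sub>E {0..}))))"

definition time_dependent_potential ::
    "('a \<times> 'a) set \<Rightarrow> (('a \<times> 'a \<Rightarrow> real) \<times> nat \<Rightarrow> real) \<Rightarrow> bool" where
  "time_dependent_potential E H \<longleftrightarrow> (\<forall>t\<ge>1. C1_orthant E (\<lambda>i. H (i, t)))"

definition total_potential ::
    "('a \<times> 'a) set \<Rightarrow> (('a \<times> 'a \<Rightarrow> real) \<times> nat \<Rightarrow> real) \<Rightarrow> nat \<Rightarrow>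
     (('a \<times> layer) \<times> ('a \<times> layer) \<Rightarrow> real) \<Rightarrow> real" where
  "total_potential E H T i = (\<Sum>t = 1..T. H (time_slice E i t, t))"

end

theory Submission
  imports Defs
begin

text \<open>
  Extend \<open>u\<close> by \<open>v(y, T+1) = u(y, \<Omega>)\<close>. On the old edges nothing changes, because there the
  two potentials differ by the constant \<open>H(0, T+1)\<close>. On the new edges \<open>j = 0\<close>, so only
  \<open>\<nabla>H - Dv \<ge> 0\<close> is needed: it is \<open>0 \<ge> 0\<close> on the exit edges at time \<open>T+1\<close>, and the hypothesis on
  \<open>\<partial>\<^sub>eH(0, T+1)\<close> on the edges \<open>(e, T+1)\<close>.
\<close>

text \<open>Both functions have exactly the same vector derivatives, so the choice operator returns
  the same value, even at a point where no derivative exists.\<close>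

lemma vector_derivative_add_const:
  "vector_derivative (\<lambda>s. f s + c) F = vector_derivative f F"
  by (simp add: vector_derivative_def has_vector_derivative_add_const)

lemma ext_edges_cases [consumes 1, case_names time exit]:
  assumes "a \<in> ext_edges N E T"
  obtains e t where "e \<in> E" "t \<in> {1..T}" "a = time_edge e t"
  | x t where "x \<in> N" "t \<in> {1..T}" "a = exit_edge x t"
  using assms unfolding ext_edges_def by blast

text \<open>The head of the edge records \<open>t\<close> itself, so truncation of
  \<open>t - 1\<close> at \<open>t = 0\<close> causes no collision.\<close>

lemma time_edge_eq_iff: "time_edge e t = time_edge e' t' \<longleftrightarrow> e = e' \<and> t = t'"
  by (auto simp: time_edge_def prod_eq_iff)

lemma exit_edge_eq_iff: "exit_edge x t = exit_edge x' t' \<longleftrightarrow> x = x' \<and> t = t'"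
  by (auto simp: exit_edge_def)

lemma time_edge_neq_exit_edge: "time_edge e t \<noteq> exit_edge x t'"
  by (simp add: time_edge_def exit_edge_def)

lemma time_edge_in_ext_edges_iff: "time_edge e t \<in> ext_edges N E T \<longleftrightarrow> e \<in> E \<and> t \<in> {1..T}"
  unfolding ext_edges_def by (blast dest: time_edge_eq_iff [THEN iffD1] time_edge_neq_exit_edge [THEN notE])

lemma exit_edge_in_ext_edges_iff: "exit_edge x t \<in> ext_edges N E T \<longleftrightarrow> x \<in> N \<and> t \<in> {1..T}"
  by (auto simp: ext_edges_def exit_edge_eq_iff time_edge_neq_exit_edge [symmetric])

text \<open>Serves to discard changes on exit edges and on time edges later than \<open>T\<close>,
  and to replace \<open>j\<close> by \<open>i\<close>.\<close>

lemma total_potential_cong: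
  assumes "\<And>e t. e \<in> E \<Longrightarrow> t \<in> {1..T} \<Longrightarrow> i (time_edge e t) = k (time_edge e t)"
  shows "total_potential E H T i = total_potential E H T k"
proof -
  have "time_slice E i t = time_slice E k t" if "t \<in> {1..T}" for t
    using that assms by (auto simp: time_slice_def)
  then show ?thesis
    by (simp add: total_potential_def)
qed

lemma total_potential_Suc:
  "total_potential E H (T + 1) i = total_potential E H T i + H (time_slice E i (T + 1), T + 1)"
  by (simp add: total_potential_def)

lemma partial_deriv_total_potential_exit_edge:
  assumes "i (exit_edge x t) \<ge> 0"
  shows "partial_deriv (total_potential E H T) (exit_edge x t) i = 0"
proof -
  have "(\<lambda>s. total_potential E H T (i(exit_edge x t := s))) = (\<lambda>s. total_potential E H T i)"
    by (intro ext total_potential_cong) (simp add: time_edge_neq_exit_edge)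
  \<comment> \<open>A constant has derivative 0, but \<open>vector_derivative\<close> returns that
    value only if derivatives are unique. A nonnegative point is a limit point of the half-line,
    approached from the right.\<close>
  moreover have "at (i (exit_edge x t)) within {0..} \<noteq> bot"
  proof -
    have "at_right (i (exit_edge x t)) \<le> at (i (exit_edge x t)) within {0..}"
      using assms by (intro at_le) auto
    then show ?thesis
      using trivial_limit_at_right_real by (metis bot.extremum_uniqueI)
  qed
  ultimately show ?thesis
    by (simp add: partial_deriv_def vector_derivative_within has_vector_derivative_const)
qed

theorem corollary4p11:
  fixes N :: "'a set" and E :: "('a \<times> 'a) set" and T :: nat
    and H :: "('a \<times> 'a \<Rightarrow> real) \<times> nat \<Rightarrow> real"
    and i j :: "('a \<times> layer) \<times> ('a \<times> layer) \<Rightarrow> real"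
    and u :: "'a \<times> layer \<Rightarrow> real"
  assumes "finite N" and "E \<subseteq> N \<times> N" and "T \<ge> 1"
    and "time_dependent_potential E H"
    and "i \<in> ext_edges N E T \<rightarrow>\<^sub>E {0..}"
    and "u \<in> ext_nodes N T \<rightarrow>\<^sub>E UNIV"
    and "\<forall>e \<in> ext_edges N E T.
           min (i e) (partial_deriv (total_potential E H T) e i - difference u e) = 0"
    and "\<forall>x \<in> N. \<forall>t \<in> {1..T}. divergence (ext_edges N E T) i (x, Time t) = 0"
    and "j = (\<lambda>e \<in> ext_edges N E (T + 1). if e \<in> ext_edges N E T then i e else 0)"
    and "\<forall>(x, y) \<in> E.
           partial_deriv (\<lambda>k. H (k, T + 1)) (x, y) (\<lambda>e\<in>E. 0) + u (x, Time T) - u (y, Omega) \<ge> 0"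
  shows "\<exists>v \<in> ext_nodes N (T + 1) \<rightarrow>\<^sub>E (UNIV :: real set).
           \<forall>e \<in> ext_edges N E (T + 1).
             min (j e) (partial_deriv (total_potential E H (T + 1)) e j - difference v e) = 0"
proof -
  define v where "v = (\<lambda>(x, l)\<in>ext_nodes N (T + 1). if l = Time (T + 1) then u (x, Omega) else u (x, l))"
  have j_old: "j e = i e" if "e \<in> ext_edges N E T" for e
    using that assms(9) by (auto elim!: ext_edges_cases
        simp: time_edge_in_ext_edges_iff exit_edge_in_ext_edges_iff)
  have j_new: "j (time_edge e (T + 1)) = 0" if "e \<in> E" for e
    using that assms(9) by (simp add: time_edge_in_ext_edges_iff)
  have j_new_exit: "j (exit_edge x (T + 1)) = 0" if "x \<in> N" for x
    using that assms(9) by (simp add: exit_edge_in_ext_edges_iff)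

  have old: "min (j a) (partial_deriv (total_potential E H (T + 1)) a j - difference v a) = 0"
    if a: "a \<in> ext_edges N E T" for a
  proof -
    have "time_edge e (T + 1) \<noteq> a" for e
      using a by (auto simp: time_edge_in_ext_edges_iff)
    \<comment> \<open>Varying an old coordinate leaves the last slice at zero, so the additional
      summand is constant in \<open>s\<close>.\<close>
    then have "time_slice E (j(a := s)) (T + 1) = (\<lambda>e\<in>E. 0)" for s
      using j_new by (simp add: time_slice_def cong: restrict_cong)
    moreover have "total_potential E H T (j(a := s)) = total_potential E H T (i(a := s))" for s
      by (rule total_potential_cong) (simp add: j_old time_edge_in_ext_edges_iff)
    \<comment> \<open>The base point of the derivative must agree too, hence \<open>j_old\<close> at
      \<open>a\<close>.\<close>
    ultimately have "partial_deriv (total_potential E H (T + 1)) a j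
        = partial_deriv (total_potential E H T) a i"
      by (simp only: partial_deriv_def total_potential_Suc vector_derivative_add_const j_old [OF a])
    \<comment> \<open>Old edges avoid the layer \<open>Time (T + 1)\<close>, and
      \<open>E \<subseteq> N \<times> N\<close> keeps their endpoints in the domain of
      \<open>v\<close>.\<close>
    moreover have "difference v a = difference u a"
      using a assms(2)
      by (cases rule: ext_edges_cases)
        (auto simp: v_def difference_def time_edge_def exit_edge_def ext_nodes_def)
    ultimately show ?thesis
      using assms(7) a by (simp add: j_old)
  qed

  have new_time: "partial_deriv (total_potential E H (T + 1)) (time_edge e (T + 1)) j
      - difference v (time_edge e (T + 1)) \<ge> 0" if e: "e \<in> E" for e
  proof -
    have "time_slice E (j(time_edge e (T + 1) := s)) (T + 1) = (\<lambda>e\<in>E. 0)(e := s)" for s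
      using e j_new by (auto simp: time_slice_def fun_eq_iff time_edge_eq_iff)
    \<comment> \<open>The roles are reversed here: the first \<open>T\<close> summands are the
      constant and only the last one varies, starting from the zero slice.\<close>
    moreover have "total_potential E H T (j(time_edge e (T + 1) := s)) = total_potential E H T j" for s
      by (rule total_potential_cong) (auto simp: time_edge_eq_iff)
    ultimately have "partial_deriv (total_potential E H (T + 1)) (time_edge e (T + 1)) j
        = partial_deriv (\<lambda>k. H (k, T + 1)) e (\<lambda>e\<in>E. 0)"
      using e by (simp only: partial_deriv_def total_potential_Suc j_new restrict_apply if_True
          add.commute [of "total_potential E H T j"] vector_derivative_add_const)
    moreover have "difference v (time_edge e (T + 1)) = u (snd e, Omega) - u (fst e, Time T)"
      using e assms(2) by (auto simp: v_def difference_def time_edge_def ext_nodes_def)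
    ultimately show ?thesis
      using assms(10) e by (auto simp: case_prod_beta)
  qed

  have "v \<in> ext_nodes N (T + 1) \<rightarrow>\<^sub>E UNIV"
    by (simp add: v_def)
  moreover have "min (j a) (partial_deriv (total_potential E H (T + 1)) a j - difference v a) = 0"
    if "a \<in> ext_edges N E (T + 1)" for a
    using that
  proof (cases rule: ext_edges_cases)
    case (time e t)
    show ?thesis
    proof (cases "t = T + 1")
      case True
      then show ?thesis
        using time new_time j_new by (simp add: min_def)
    next
      case False
      then show ?thesis
        using time by (intro old) (auto simp: time_edge_in_ext_edges_iff)
    qed
  next
    case (exit x t)
    show ?thesis
    proof (cases "t = T + 1")
      case True
      \<comment> \<open>Both endpoints carry the value \<open>u (x, Omega)\<close>.\<close>
      have "difference v (exit_edge x (T + 1)) = 0"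
        using exit by (simp add: v_def difference_def exit_edge_def ext_nodes_def)
      then show ?thesis
        using exit True j_new_exit
        by (simp add: partial_deriv_total_potential_exit_edge)
    next
      case False
      then show ?thesis
        using exit by (intro old) (auto simp: exit_edge_in_ext_edges_iff)
    qed
  qed
  ultimately show ?thesis
    by blast
qed

end
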